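(* Let $d\ge 1$ be an integer, let $\mathcal{A}=\mathcal{M}(2d,\mathbb{C})$ regarded as a real algebra (so $\dim_{\mathbb{R}}\mathcal{A}=8d^2$), and let $\omega=i\mathbf{1}$. Then: (1) The map $\epsilon\mapsto i(2\epsilon-\mathbf{1})$ is a bijection from the set of idempotents of $\mathcal{A}$ onto the set of square roots of $-\mathbf{1}$ in $\mathcal{A}$. (2) For every square root $f$ of $-\mathbf{1}$ in $\mathcal{A}$, $\mathbb{C}^{2d}$ is the direct sum of the eigenspaces of $f$ for the eigenvalues $i$ and $-i$, and there is an integer $k$ with $-d\le k\le d$ such that these eigenspaces have complex dimensions $d+k$ and $d-k$ respectively. Moreover $\mathrm{Scal}(f)=0$ and $\mathrm{Spec}(f)=k/d$. (3) Two square roots of $-\mathbf{1}$ are conjugate if and only if they have the same integer $k$. The square roots of $-\mathbf{1}$ thus constitute exactly $2d+1$ conjugacy classes, and these classes are also the connected components of the submanifold of square roots of $-\mathbf{1}$. (4) The conjugacy class associated with $k$ has real dimension $4(d^2-k^2)$. In particular the class with $k=0$ (the ordinary square roots) has dimension $\dim_{\mathbb{R}}(\mathcal{A})/2$, and the $2d$ classes with $k\ne 0$ (the exceptional square roots) have dimension $<\dim_{\mathbb{R}}(\mathcal{A})/2$. (5) Entrywise complex conjugation, which is an automorphism of the real algebra $\mathcal{A}$, maps the class associated with $k$ to the class associated with $-k$; in particular it leaves the class of ordinary square roots invariant and maps the class $\{\omega\}$ (associated with $k=d$) to the class $\{-\omega\}$ (associated with $k=-d$).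
   Context: $\mathbf{1}$ is the unit matrix. Two elements $f,g\in\mathcal{A}$ are conjugate if $g=a^{-1}fa$ for some invertible $a\in\mathcal{A}$. $\mathcal{A}$ carries its usual topology as a finite-dimensional real vector space. The center $\mathrm{Z}(\mathcal{A})=\mathbb{C}\mathbf{1}$ is spanned over $\mathbb{R}$ by $\mathbf{1}$ and $\omega$, and $\mathcal{A}=\mathrm{Z}(\mathcal{A})\oplus[\mathcal{A},\mathcal{A}]$, where $[\mathcal{A},\mathcal{A}]$ is the span of all commutators $fg-gf$. The real-linear forms $\mathrm{Scal},\mathrm{Spec}:\mathcal{A}\to\mathbb{R}$ are defined by: $\mathrm{Scal}(f)\mathbf{1}+\mathrm{Spec}(f)\,\omega$ is the projection of $f$ onto $\mathrm{Z}(\mathcal{A})$ along $[\mathcal{A},\mathcal{A}]$. *)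

theory Defs
  imports "HOL-Analysis.Analysis"
begin

text \<open>
  The algebra of all complex matrices of order \<open>2 * d\<close> is the type \<^typ>\<open>complex^'n^'n\<close> with
  \<open>CARD('n) = 2 * d\<close>. Its product is \<open>**\<close> and its unit is \<open>mat 1\<close>; the product
  \<open>*\<close> of the library on this type is entrywise and is not used. As a real vector
  space and as a topological space it is the library's Euclidean space.
\<close>

subsection \<open>Matrix algebra\<close>

definition omega :: "complex^'n^'n"
  where "omega = mat \<i>"

definition idempotents :: "(complex^'n^'n) set"
  where "idempotents = {e. e ** e = e}"

definition square_roots :: "(complex^'n^'n) set"
  where "square_roots = {f. f ** f = - mat 1}"

definition conjugate :: "complex^'n^'n \<Rightarrow> complex^'n^'n \<Rightarrow> bool"
  where "conjugate f g \<longleftrightarrow> (\<exists>a. invertible a \<and> g = matrix_inv a ** f ** a)"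

definition conj_class :: "complex^'n^'n \<Rightarrow> (complex^'n^'n) set"
  where "conj_class f = {g. conjugate f g}"

definition cnj_matrix :: "complex^'n^'n \<Rightarrow> complex^'n^'n"
  where "cnj_matrix f = (\<chi> i j. cnj (f $ i $ j))"

definition real_algebra_automorphism :: "(complex^'n^'n \<Rightarrow> complex^'n^'n) \<Rightarrow> bool"
  where "real_algebra_automorphism h \<longleftrightarrow>
    bij h \<and> linear h \<and> (\<forall>f g. h (f ** g) = h f ** h g) \<and> h (mat 1) = mat 1"

definition matrix_center :: "(complex^'n^'n) set"
  where "matrix_center = {z. \<forall>f. z ** f = f ** z}"

definition commutator_space :: "(complex^'n^'n) set"
  where "commutator_space = span {f ** g - g ** f | f g. True}"

text \<open>
  The algebra is the direct sum of \<^term>\<open>matrix_center\<close> and \<^term>\<open>commutator_space\<close>, and the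
  former has real basis \<^term>\<open>mat 1\<close>, \<^term>\<open>omega\<close>; hence the descriptions below are unique.
\<close>

definition center_projection :: "complex^'n^'n \<Rightarrow> complex^'n^'n"
  where "center_projection f = (THE z. z \<in> matrix_center \<and> f - z \<in> commutator_space)"

definition Scal :: "complex^'n^'n \<Rightarrow> real"
  where "Scal f = (THE s. \<exists>t. center_projection f = s *\<^sub>R mat 1 + t *\<^sub>R omega)"

definition Spec :: "complex^'n^'n \<Rightarrow> real"
  where "Spec f = (THE t. \<exists>s. center_projection f = s *\<^sub>R mat 1 + t *\<^sub>R omega)"

text \<open>Eigenspaces are complex subspaces; their complex dimension is \<^const>\<open>vec.dim\<close>.\<close>

definition eigenspace :: "complex^'n^'n \<Rightarrow> complex \<Rightarrow> (complex^'n) set"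
  where "eigenspace f c = {v. f *v v = c *s v}"

definition has_index :: "nat \<Rightarrow> complex^'n^'n \<Rightarrow> int \<Rightarrow> bool"
  where "has_index d f k \<longleftrightarrow>
    int (vec.dim (eigenspace f \<i>)) = int d + k \<and>
    int (vec.dim (eigenspace f (- \<i>))) = int d - k"

definition root_class :: "nat \<Rightarrow> int \<Rightarrow> (complex^'n^'n) set"
  where "root_class d k = {f \<in> square_roots. has_index d f k}"

subsection \<open>Smooth embedded submanifolds of a Euclidean space\<close>

text \<open>
  \<open>Ck_on k f S\<close>, meant for open \<open>S\<close>: \<open>f\<close> is \<open>k\<close> times continuously differentiable on \<open>S\<close>
  (differentiable, with every directional derivative \<open>k - 1\<close> times continuously
  differentiable).
\<close>

primrec Ck_on ::
    "nat \<Rightarrow> ('a::euclidean_space \<Rightarrow> 'b::euclidean_space) \<Rightarrow> 'a set \<Rightarrow> bool" where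
  "Ck_on 0 f S \<longleftrightarrow> continuous_on S f"
| "Ck_on (Suc k) f S \<longleftrightarrow>
     (\<forall>x\<in>S. f differentiable (at x)) \<and>
     (\<forall>v. Ck_on k (\<lambda>x. frechet_derivative f (at x) v) S)"

definition smooth_on :: "('a::euclidean_space \<Rightarrow> 'b::euclidean_space) \<Rightarrow> 'a set \<Rightarrow> bool"
  where "smooth_on f S \<longleftrightarrow> (\<forall>k. Ck_on k f S)"

definition smooth_diffeomorphism ::
    "'a::euclidean_space set \<Rightarrow> 'a set \<Rightarrow> ('a \<Rightarrow> 'a) \<Rightarrow> ('a \<Rightarrow> 'a) \<Rightarrow> bool"
  where "smooth_diffeomorphism U V \<phi> \<psi> \<longleftrightarrow>
    open U \<and> open V \<and> homeomorphism U V \<phi> \<psi> \<and> smooth_on \<phi> U \<and> smooth_on \<psi> V"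

definition submanifold_at :: "'a::euclidean_space set \<Rightarrow> nat \<Rightarrow> 'a \<Rightarrow> bool"
  where "submanifold_at S m p \<longleftrightarrow>
    (\<exists>U V \<phi> \<psi> L. p \<in> U \<and> smooth_diffeomorphism U V \<phi> \<psi> \<and>
       subspace L \<and> dim L = m \<and> \<phi> ` (U \<inter> S) = V \<inter> L)"

definition submanifold_of_dim :: "'a::euclidean_space set \<Rightarrow> nat \<Rightarrow> bool"
  where "submanifold_of_dim S m \<longleftrightarrow> (\<forall>p\<in>S. submanifold_at S m p)"

text \<open>Here the components may have different dimensions.\<close>

definition submanifold :: "'a::euclidean_space set \<Rightarrow> bool"
  where "submanifold S \<longleftrightarrow> (\<forall>p\<in>S. \<exists>m. submanifold_at S m p)"

end

(*
  A square root f of -1 splits the space into its eigenspaces for i and -i, hence is conjugate to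
  the diagonal matrix with entries i on a set P of indices and -i elsewhere, where |P| = d + k; its
  trace is 2 i k, which determines k.

  Charts: for a square root p of -1, the Cayley transform f |-> (1 - p f)^-1 (1 + p f) maps a
  neighbourhood of p onto an open set of matrices x, with inverse x |-> p (1 - x) (1 + x)^-1, and it
  straightens the square roots of -1 to the real subspace {x. p x = - x p}. For x in this subspace
  the inverse takes the value (1 + x) p (1 + x)^-1, so the square roots near p are conjugate to p.
  Thus conjugacy classes are open in the set of square roots; they are connected because
  (1 - z) a + z is invertible for all but finitely many complex z if a is.
*)
theory Submission
  imports Defs
begin

section \<open>Matrix inversion and differentiability classes\<close>

text \<open>Why the Cayley transform straightens: put c = 1 - p f and w = c^-1, so that the chart is
  2 w - 1. Multiplying out, f f = -1 is equivalent to c p + p c = c p c, and multiplying by w on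
  both sides gives p w + w p = p. The quadratic equation has become a linear one, and passing from w
  to 2 w - 1 makes it homogeneous. The obstacle is smoothness to every order, which is defined by
  iterated directional derivatives. The derivative of h = (b + L x)^-1 in direction v is - h (L v)
  h, again a product of copies of h and a constant, so an induction over the order gets by with a
  Leibniz rule and never composes smooth maps. The dimension formula counts entries: for diagonal p
  the subspace consists of the matrices supported on two off-diagonal blocks with (d + k)(d - k)
  complex entries each, which makes 4 (d^2 - k^2) real dimensions.\<close>

lemma bounded_bilinear_matrix_mult:
  "bounded_bilinear ((**) :: 'a::{real_normed_algebra_1,euclidean_space}^'n^'m \<Rightarrow> 'a^'p^'n \<Rightarrow> 'a^'p^'m)"
proof -
  have "linear (\<lambda>B :: 'a^'p^'n. A ** B)" for A :: "'a^'n^'m"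
    by (rule linearI) (simp_all add: matrix_matrix_mult_def vec_eq_iff distrib_left sum.distrib scaleR_sum_right)
  moreover have "linear (\<lambda>A :: 'a^'n^'m. A ** B)" for B :: "'a^'p^'n"
    by (rule linearI) (simp_all add: matrix_matrix_mult_def vec_eq_iff distrib_right sum.distrib scaleR_sum_right)
  ultimately show ?thesis
    by (simp add: bilinear_def flip: bilinear_conv_bounded_bilinear)
qed

interpretation matrix_mult: bounded_bilinear
  "(**) :: complex^'n^'n \<Rightarrow> complex^'n^'n \<Rightarrow> complex^'n^'n"
  by (rule bounded_bilinear_matrix_mult)

lemmas matrix_mult_distribs =
  matrix_mult.add_left matrix_mult.add_right matrix_mult.diff_left matrix_mult.diff_right
  matrix_mult.minus_left matrix_mult.minus_right matrix_mult.scaleR_left matrix_mult.scaleR_right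

lemma mat_mult_component [simp]: "(mat c ** A) $ i $ j = c * A $ i $ j"
  for A :: "'a::semiring_1^'n^'m"
  by (simp add: matrix_matrix_mult_def mat_def if_distrib if_distribR cong: if_cong)

lemma mult_mat_component [simp]: "(A ** mat c) $ i $ j = A $ i $ j * c"
  for A :: "'a::semiring_1^'n^'m"
  by (simp add: matrix_matrix_mult_def mat_def if_distrib if_distribR cong: if_cong)

lemma mat_mult_commute: "mat c ** A = A ** mat c"
  for A :: "'a::comm_semiring_1^'n^'n"
  by (simp add: vec_eq_iff mult.commute)

lemma mat_mult_mat: "mat a ** mat b = (mat (a * b) :: 'a::semiring_1^'n^'n)"
  by (simp add: vec_eq_iff) (simp add: mat_def)

lemma uminus_mat: "- mat c = (mat (- c) :: 'a::ring_1^'n^'n)"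
  by (simp add: vec_eq_iff mat_def)

lemma mat_vector_mult [simp]: "mat c *v x = c *s x"
  for x :: "'a::semiring_1^'n"
  by (simp add: vec_eq_iff matrix_vector_mult_def mat_def if_distrib if_distribR cong: if_cong)

section \<open>Matrix inversion: algebra, continuity, derivative\<close>

lemma matrix_inv_right [simp]: "invertible A \<Longrightarrow> A ** matrix_inv A = mat 1"
  and matrix_inv_left [simp]: "invertible A \<Longrightarrow> matrix_inv A ** A = mat 1"
  for A :: "'a::semiring_1^'n^'m"
  using someI_ex [of "\<lambda>B. A ** B = mat 1 \<and> B ** A = mat 1"]
  by (auto simp: invertible_def matrix_inv_def)

lemma invertible_matrix_inv [simp]: "invertible A \<Longrightarrow> invertible (matrix_inv A)"
  for A :: "'a::semiring_1^'n^'m"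
  using invertible_def matrix_inv_left matrix_inv_right by blast

lemma matrix_inv_unique_right:
  fixes A :: "'a::semiring_1^'n^'n"
  assumes "invertible A" "A ** B = mat 1"
  shows "matrix_inv A = B"
  by (metis assms matrix_inv_left matrix_mul_assoc matrix_mul_lid matrix_mul_rid)

lemma invertibleI_left: "B ** A = mat 1 \<Longrightarrow> invertible A"
  for A :: "'a::field^'n^'n"
  using invertible_left_inverse by blast

text \<open>Cramer's rule for column \<open>j\<close> of the inverse, the solution of
  \<open>A *v x = axis j 1\<close>. The entries become quotients of polynomials in the entries of
  \<open>A\<close>, which is how inversion is shown to be continuous.\<close>

lemma matrix_inv_component:
  fixes A :: "'a::field^'n^'n"
  assumes "invertible A"
  shows "matrix_inv A $ k $ j = det (\<chi> i l. if l = k then axis j 1 $ i else A $ i $ l) / det A"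
proof -
  let ?x = "column j (matrix_inv A)"
  have det: "det A \<noteq> 0"
    using assms invertible_det_nz by blast
  have "A *v ?x = column j (A ** matrix_inv A)"
    by (simp add: vec_eq_iff column_def matrix_matrix_mult_def matrix_vector_mult_def)
  also have "\<dots> = axis j 1"
    using assms by (simp add: vec_eq_iff column_def mat_def axis_def)
  finally have "?x = (\<chi> k. det (\<chi> i l. if l = k then axis j 1 $ i else A $ i $ l) / det A)"
    by (rule cramer [OF det, THEN iffD1])
  then have "?x $ k = det (\<chi> i l. if l = k then axis j 1 $ i else A $ i $ l) / det A"
    by (simp only: vec_lambda_beta)
  then show ?thesis
    by (simp add: column_def)
qed

lemma continuous_on_det [continuous_intros]:
  fixes f :: "'b::topological_space \<Rightarrow> 'a::{real_normed_field}^'n^'n"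
  assumes "\<And>i j. continuous_on S (\<lambda>x. f x $ i $ j)"
  shows "continuous_on S (\<lambda>x. det (f x))"
  unfolding det_def by (intro continuous_intros assms)

lemma continuous_on_matrix_inv:
  "continuous_on {A :: complex^'n^'n. invertible A} matrix_inv"
proof -
  have "continuous_on {A :: complex^'n^'n. invertible A}
     (\<lambda>A. \<chi> k j. det (\<chi> i l. if l = k then axis j 1 $ i else A $ i $ l) / det A)"
  proof (intro continuous_intros, simp_all add: invertible_det_nz)
    fix k j i l :: 'n
    show "continuous_on {A :: complex^'n^'n. det A \<noteq> 0} (\<lambda>A. if l = k then axis j 1 $ i else A $ i $ l)"
      by (cases "l = k") (auto intro!: continuous_intros)
  qed
  then show ?thesis
    by (rule continuous_on_cong [THEN iffD1, rotated -1])
       (simp_all add: vec_eq_iff matrix_inv_component)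
qed

lemma open_invertible: "open {A :: complex^'n^'n. invertible A}"
proof -
  have "continuous_on UNIV (det :: complex^'n^'n \<Rightarrow> complex)"
    by (intro continuous_intros)
  then show ?thesis
    unfolding invertible_det_nz
    using open_Collect_neq continuous_on_const by blast
qed

lemma has_derivative_matrix_inv:
  fixes A :: "complex^'n^'n"
  assumes "invertible A"
  shows "(matrix_inv has_derivative (\<lambda>v. - (matrix_inv A ** v ** matrix_inv A))) (at A)"
proof -
  let ?I = "matrix_inv :: complex^'n^'n \<Rightarrow> _"
  obtain K where K: "K > 0" "\<And>a b. norm ((a :: complex^'n^'n) ** (b :: complex^'n^'n)) \<le> norm a * norm b * K"
    using matrix_mult.pos_bounded by blast
  have cont: "(?I \<longlongrightarrow> ?I A) (at A)"
  proof (rule isContD)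
    show "isCont ?I A"
      using continuous_on_interior [OF continuous_on_matrix_inv] assms
      by (simp add: interior_open [OF open_invertible])
  qed
  \<comment> \<open>The remainder of the linear approximation has two factors that tend to 0. After
    division by \<open>norm (B - A)\<close> the factor \<open>?I A - ?I B\<close> is left, and
    continuity alone makes it vanish in the limit.\<close>
  have eq: "?I B - ?I A + ?I A ** (B - A) ** ?I A = (?I A - ?I B) ** (B - A) ** ?I A"
    if "invertible B" for B
  proof -
    have "?I B ** A ** ?I A = ?I B"
      using assms by (simp flip: matrix_mul_assoc)
    then show ?thesis
      using that assms
      by (simp only: matrix_mult_distribs matrix_inv_left matrix_mul_lid) simp
  qed
  show ?thesis
    unfolding has_derivative_iff_norm
  proof (intro conjI)
    show "bounded_linear (\<lambda>v. - (?I A ** v ** ?I A))"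
      by (rule bounded_linear_minus [OF bounded_linear_compose
            [OF matrix_mult.bounded_linear_left matrix_mult.bounded_linear_right]])
    show "((\<lambda>B. norm (?I B - ?I A - - (?I A ** (B - A) ** ?I A)) / norm (B - A)) \<longlongrightarrow> 0) (at A)"
    proof (rule Lim_null_comparison)
      have "\<forall>\<^sub>F B in at A. invertible B"
        using open_invertible assms eventually_at_topological by blast
      moreover have "\<forall>\<^sub>F B in at A. B \<noteq> A"
        by (simp add: eventually_at_filter)
      ultimately show "\<forall>\<^sub>F B in at A. norm (norm (?I B - ?I A - - (?I A ** (B - A) ** ?I A)) / norm (B - A))
          \<le> norm (?I A - ?I B) * K * norm (?I A) * K"
      proof eventually_elim
        case (elim B)
        have "norm ((?I A - ?I B) ** (B - A) ** ?I A) \<le> norm ((?I A - ?I B) ** (B - A)) * norm (?I A) * K"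
          by (rule K)
        also have "\<dots> \<le> (norm (?I A - ?I B) * norm (B - A) * K) * norm (?I A) * K"
          using K by (intro mult_right_mono) auto
        finally show ?case
          using elim by (simp add: eq divide_le_eq mult_ac)
      qed
      have "((\<lambda>B. norm (?I A - ?I B) * K * norm (?I A) * K) \<longlongrightarrow> norm (?I A - ?I A) * K * norm (?I A) * K) (at A)"
        by (intro tendsto_intros cont)
      then show "((\<lambda>B. norm (?I A - ?I B) * K * norm (?I A) * K) \<longlongrightarrow> 0) (at A)"
        by simp
    qed
  qed
qed

section \<open>Calculus of k times continuously differentiable maps\<close>

text \<open>Derivatives at a point of the open set \<open>S\<close> involve only values on
  \<open>S\<close>, so agreement on \<open>S\<close> passes to derivatives of all orders.\<close>

lemma Ck_on_cong:
  assumes "open S" "\<And>x. x \<in> S \<Longrightarrow> f x = g x" "Ck_on k f S"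
  shows "Ck_on k g S"
  using assms(2,3)
proof (induction k arbitrary: f g)
  case 0
  then show ?case
    by (metis Ck_on.simps(1) continuous_on_cong)
next
  case (Suc k)
  have der: "(g has_derivative frechet_derivative f (at x)) (at x)" if "x \<in> S" for x
    using Suc.prems that \<open>open S\<close>
    by (metis Ck_on.simps(2) frechet_derivative_works has_derivative_transform_within_open)
  have "Ck_on k (\<lambda>x. frechet_derivative g (at x) v) S" for v
    by (rule Suc.IH [of "\<lambda>x. frechet_derivative f (at x) v"])
       (use Suc.prems der frechet_derivative_at in fastforce)+
  then show ?case
    using der by (auto simp: differentiable_def)
qed

text \<open>By uniqueness of derivatives, an explicit formula may replace
  \<open>frechet_derivative\<close>, which is only given by choice.\<close>

lemma Ck_on_SucI:
  assumes "open S"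
    and "\<And>x. x \<in> S \<Longrightarrow> (f has_derivative (\<lambda>v. f' v x)) (at x)"
    and "\<And>v. Ck_on k (f' v) S"
  shows "Ck_on (Suc k) f S"
proof -
  have "Ck_on k (\<lambda>x. frechet_derivative f (at x) v) S" for v
    by (rule Ck_on_cong [OF assms(1) _ assms(3) [of v]])
       (simp flip: frechet_derivative_at [OF assms(2)])
  then show ?thesis
    using assms(2) by (auto simp: differentiable_def)
qed

lemma Ck_on_SucD:
  assumes "Ck_on (Suc k) f S"
  shows "x \<in> S \<Longrightarrow> (f has_derivative (\<lambda>v. frechet_derivative f (at x) v)) (at x)"
    and "Ck_on k (\<lambda>x. frechet_derivative f (at x) v) S"
  using assms by (auto simp: frechet_derivative_works)

lemma Ck_on_Suc_imp:
  assumes "open S"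
  shows "Ck_on (Suc k) f S \<Longrightarrow> Ck_on k f S"
proof (induction k arbitrary: f)
  case 0
  then show ?case
    by (simp add: continuous_at_imp_continuous_on differentiable_imp_continuous_within)
qed auto

lemma Ck_on_const: "open S \<Longrightarrow> Ck_on k (\<lambda>x. c) S"
proof (induction k arbitrary: c)
  case (Suc k)
  then show ?case
    by (intro Ck_on_SucI [where f' = "\<lambda>v x. 0"]) auto
qed simp

lemma Ck_on_add:
  assumes "open S"
  shows "Ck_on k f S \<Longrightarrow> Ck_on k g S \<Longrightarrow> Ck_on k (\<lambda>x. f x + g x) S"
proof (induction k arbitrary: f g)
  case 0
  then show ?case by (simp add: continuous_on_add)
next
  case (Suc k)
  note f' = Ck_on_SucD [OF Suc.prems(1)]
  note g' = Ck_on_SucD [OF Suc.prems(2)]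
  show ?case
    by (rule Ck_on_SucI [OF assms has_derivative_add [OF f'(1) g'(1)] Suc.IH [OF f'(2) g'(2)]])
qed

text \<open>A Leibniz rule that serves scalar multiplication and the matrix product alike. Each term
  of the derivative keeps one factor undifferentiated, and the induction needs that factor at order
  \<open>k\<close>; hence \<open>Ck_on_Suc_imp\<close>.\<close>

lemma Ck_on_bilinear:
  fixes B :: "'a::euclidean_space \<Rightarrow> 'b::euclidean_space \<Rightarrow> 'c::euclidean_space"
  assumes "bounded_bilinear B" "open S"
  shows "Ck_on k f S \<Longrightarrow> Ck_on k g S \<Longrightarrow> Ck_on k (\<lambda>x. B (f x) (g x)) S"
proof (induction k arbitrary: f g)
  case 0
  then show ?case
    by (simp add: bounded_bilinear.continuous_on [OF assms(1)])
next
  case (Suc k)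
  note fg = Suc.prems [THEN Ck_on_Suc_imp [OF assms(2)]]
  note f' = Ck_on_SucD [OF Suc.prems(1)]
  note g' = Ck_on_SucD [OF Suc.prems(2)]
  show ?case
  proof (rule Ck_on_SucI [OF assms(2)])
    show "((\<lambda>x. B (f x) (g x)) has_derivative
        (\<lambda>v. B (f x) (frechet_derivative g (at x) v) + B (frechet_derivative f (at x) v) (g x))) (at x)"
      if "x \<in> S" for x
      by (rule bounded_bilinear.FDERIV [OF assms(1) f'(1) g'(1), OF that that])
    show "Ck_on k (\<lambda>x. B (f x) (frechet_derivative g (at x) v) + B (frechet_derivative f (at x) v) (g x)) S" for v
      by (rule Ck_on_add [OF assms(2) Suc.IH [OF fg(1) g'(2)] Suc.IH [OF f'(2) fg(2)]])
  qed
qed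

lemma Ck_on_matrix_inv_affine:
  fixes L :: "'a::euclidean_space \<Rightarrow> complex^'n^'n"
  assumes "bounded_linear L" and S: "open S" "\<And>x. x \<in> S \<Longrightarrow> invertible (b + L x)"
  shows "Ck_on k (\<lambda>x. matrix_inv (b + L x)) S"
proof (induction k)
  case 0
  have "continuous_on S (\<lambda>x. b + L x)"
    using assms by (intro continuous_intros linear_continuous_on)
  then show ?case
    using S by (auto intro!: continuous_on_compose2 [OF continuous_on_matrix_inv])
next
  case (Suc k)
  let ?h = "\<lambda>x. matrix_inv (b + L x)"
  have "(?h has_derivative (\<lambda>v. - (?h x ** L v ** ?h x))) (at x)" if "x \<in> S" for x
  proof (rule has_derivative_compose [of "\<lambda>x. b + L x" L])
    show "((\<lambda>x. b + L x) has_derivative L) (at x)"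
      using bounded_linear_imp_has_derivative [OF assms(1)] by (auto intro!: derivative_eq_intros)
    show "(matrix_inv has_derivative (\<lambda>v. - (?h x ** v ** ?h x))) (at (b + L x))"
      using S that by (intro has_derivative_matrix_inv)
  qed
  \<comment> \<open>The sign is moved inside so that the derivative is a product of
    \<open>?h\<close>, a constant and \<open>?h\<close>, to which the Leibniz rule and the induction
    hypothesis apply.\<close>
  then have der: "(?h has_derivative (\<lambda>v. ?h x ** - L v ** ?h x)) (at x)" if "x \<in> S" for x
    using that by (simp add: matrix_mult_distribs)
  note mult = Ck_on_bilinear [OF bounded_bilinear_matrix_mult S(1)]
  show ?case
    by (rule Ck_on_SucI [OF S(1) der mult [OF mult [OF Suc Ck_on_const [OF S(1)]] Suc]])
qed

section \<open>Conjugacy and eigenspaces\<close>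

text \<open>The intertwining form contains no inverse: it composes under products of
  \<open>a\<close> and can be checked column by column.\<close>

lemma conjugate_iff: "conjugate f g \<longleftrightarrow> (\<exists>a. invertible a \<and> f ** a = a ** g)"
  unfolding conjugate_def
  by (metis matrix_inv_left matrix_inv_right matrix_mul_assoc matrix_mul_lid)

lemma conjugate_refl: "conjugate f f"
  unfolding conjugate_iff by (metis invertible_def matrix_mul_lid matrix_mul_rid)

lemma conjugate_sym: "conjugate f g \<Longrightarrow> conjugate g f"
  unfolding conjugate_iff
  by (metis invertible_matrix_inv matrix_inv_left matrix_inv_right matrix_mul_assoc matrix_mul_lid matrix_mul_rid)

lemma conjugate_trans: "conjugate f g \<Longrightarrow> conjugate g h \<Longrightarrow> conjugate f h"
  unfolding conjugate_iff by (metis invertible_mult matrix_mul_assoc)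

lemma conj_class_eq_iff: "conj_class f = conj_class g \<longleftrightarrow> conjugate f g"
  unfolding conj_class_def using conjugate_refl conjugate_sym conjugate_trans by blast

lemma conjugate_square_roots:
  assumes "conjugate f g" "f \<in> square_roots"
  shows "g \<in> square_roots"
proof -
  obtain a where a: "invertible a" "g = matrix_inv a ** f ** a"
    using assms(1) unfolding conjugate_def by blast
  have "g ** g = matrix_inv a ** f ** (a ** matrix_inv a) ** f ** a"
    by (simp add: a(2) matrix_mul_assoc)
  also have "\<dots> = matrix_inv a ** (f ** f) ** a"
    by (simp add: a matrix_mul_assoc)
  also have "\<dots> = - mat 1"
    using assms(2) a by (simp add: square_roots_def matrix_mult_distribs)
  finally show ?thesis
    by (simp add: square_roots_def)
qed

lemma conjugate_trace:
  assumes "conjugate f g"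
  shows "trace f = trace g"
proof -
  obtain a where a: "invertible a" "g = matrix_inv a ** f ** a"
    using assms(1) unfolding conjugate_def by blast
  have "trace g = trace (a ** (matrix_inv a ** f))"
    unfolding a(2) by (rule trace_mul_sym)
  then show ?thesis
    using a(1) by (simp add: matrix_mul_assoc)
qed

text \<open>By the intertwining relation, \<open>a\<close> restricts to a linear bijection from the
  eigenspace of \<open>g\<close> onto that of \<open>f\<close>.\<close>

lemma conjugate_dim_eigenspace:
  assumes "conjugate f g"
  shows "vec.dim (eigenspace f c) = vec.dim (eigenspace g c)"
proof -
  obtain a where a: "invertible a" "f ** a = a ** g"
    using assms unfolding conjugate_iff by blast
  have inj: "inj ((*v) a)"
    by (rule inj_matrix_vector_mult [OF a(1)])
  have "eigenspace f c = (*v) a ` eigenspace g c"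
  proof (intro equalityI subsetI)
    fix v assume v: "v \<in> eigenspace f c"
    let ?w = "matrix_inv a *v v"
    have w: "v = a *v ?w"
      using a by (simp add: matrix_vector_mul_assoc)
    have "a *v (g *v ?w) = f *v (a *v ?w)"
      by (simp only: matrix_vector_mul_assoc matrix_mul_assoc a(2))
    also have "\<dots> = c *s v"
      using v by (simp add: eigenspace_def flip: w)
    also have "\<dots> = a *v (c *s ?w)"
      by (simp add: vector_scalar_commute flip: w)
    finally have "?w \<in> eigenspace g c"
      using inj by (simp add: eigenspace_def inj_eq)
    with w show "v \<in> (*v) a ` eigenspace g c"
      by blast
  next
    fix v assume "v \<in> (*v) a ` eigenspace g c"
    then obtain w where w: "v = a *v w" "g *v w = c *s w"
      by (auto simp: eigenspace_def)
    have "f *v (a *v w) = a *v (g *v w)"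
      by (simp only: matrix_vector_mul_assoc a(2))
    then show "v \<in> eigenspace f c"
      by (simp add: eigenspace_def w vector_scalar_commute)
  qed
  then show ?thesis
    by (simp add: vec.dim_image_eq inj_on_subset [OF inj])
qed

lemma conjugate_has_index: "conjugate f g \<Longrightarrow> has_index d f k \<longleftrightarrow> has_index d g k"
  by (simp add: has_index_def conjugate_dim_eigenspace)

lemma has_index_unique: "has_index d f k \<Longrightarrow> has_index d f l \<Longrightarrow> k = l"
  by (simp add: has_index_def)

section \<open>Eigenspace decomposition and diagonal normal form\<close>

lemma subspace_eigenspace: "vec.subspace (eigenspace f c)"
  by (auto simp: vec.subspace_def eigenspace_def matrix_vector_right_distrib vector_scalar_commute vec_eq_iff algebra_simps)

lemma square_root_apply_twice:
  "f \<in> square_roots \<Longrightarrow> f *v (f *v v) = - v"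
  by (simp add: square_roots_def matrix_vector_mul_assoc uminus_mat vector_smult_lneg)

lemma eigenspaces_sum:
  assumes "f \<in> square_roots"
  shows "{x + y | x y. x \<in> eigenspace f \<i> \<and> y \<in> eigenspace f (- \<i>)} = UNIV"
proof -
  have "\<exists>x y. v = x + y \<and> x \<in> eigenspace f \<i> \<and> y \<in> eigenspace f (- \<i>)" for v
  proof (intro exI conjI)
    \<comment> \<open>(1 - \<i> f) / 2 and (1 + \<i> f) / 2 are the projections onto the two
      eigenspaces.\<close>
    let ?x = "(1/2) *s (v - \<i> *s (f *v v))" and ?y = "(1/2) *s (v + \<i> *s (f *v v))"
    show "v = ?x + ?y"
      by (simp add: vec_eq_iff algebra_simps)
    show "?x \<in> eigenspace f \<i>" "?y \<in> eigenspace f (- \<i>)"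
      using square_root_apply_twice [OF assms]
      by (simp_all add: eigenspace_def vector_scalar_commute matrix_vector_right_distrib
          matrix_vector_mult_diff_distrib vec_eq_iff algebra_simps)
  qed
  then show ?thesis
    by blast
qed

lemma eigenspaces_Int: "eigenspace f \<i> \<inter> eigenspace f (- \<i>) = {0}"
  by (auto simp: eigenspace_def vec_eq_iff)

lemma dim_eigenspaces:
  fixes f :: "complex^'n^'n"
  assumes "f \<in> square_roots"
  shows "vec.dim (eigenspace f \<i>) + vec.dim (eigenspace f (- \<i>)) = CARD('n)"
  using vec.dim_sums_Int [OF subspace_eigenspace subspace_eigenspace, of f \<i> f "-\<i>"]
  by (simp add: eigenspaces_sum [OF assms] eigenspaces_Int vec_dim_card card_cart_basis)

definition diag_root :: "'n set \<Rightarrow> complex^'n^'n"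
  where "diag_root P = (\<chi> i j. if i = j then if j \<in> P then \<i> else - \<i> else 0)"

lemmas if_mult_distribs = if_distrib [of "(*) c" for c] if_distrib [of "\<lambda>x. x * c" for c]

lemma diag_root_mult_component:
  "(diag_root P ** A) $ i $ j = (if i \<in> P then \<i> else - \<i>) * A $ i $ j"
  by (simp add: diag_root_def matrix_matrix_mult_def if_mult_distribs cong: if_cong)

lemma mult_diag_root_component:
  "(A ** diag_root P) $ i $ j = A $ i $ j * (if j \<in> P then \<i> else - \<i>)"
  by (simp add: diag_root_def matrix_matrix_mult_def if_mult_distribs cong: if_cong)

lemma diag_root_in_square_roots: "diag_root P \<in> square_roots"
  by (simp add: square_roots_def vec_eq_iff mult_diag_root_component)
     (simp add: diag_root_def mat_def)

lemma trace_diag_root: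
  "trace (diag_root P :: complex^'n^'n) = \<i> * (of_nat (card P) - of_nat (card (- P)))"
proof -
  have "trace (diag_root P :: complex^'n^'n) = (\<Sum>i\<in>UNIV. if i \<in> P then \<i> else - \<i>)"
    by (simp add: trace_def diag_root_def)
  also have "\<dots> = \<i> * (of_nat (card P) - of_nat (card (- P)))"
    by (simp add: sum.If_cases algebra_simps flip: Compl_eq)
  finally show ?thesis .
qed

text \<open>The columns of the conjugating matrix \<open>a\<close> form an eigenbasis, with the
  eigenvectors for \<open>\<i>\<close> at the positions in \<open>P\<close>. Only the size of
  \<open>P\<close> matters, so two roots with equal dimensions can be brought to the same diagonal
  matrix.\<close>

lemma square_root_conjugate_diag_root:
  fixes f :: "complex^'n^'n"
  assumes f: "f \<in> square_roots" and P: "card P = vec.dim (eigenspace f \<i>)"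
  shows "conjugate f (diag_root P)"
proof -
  obtain B C where
    B: "B \<subseteq> eigenspace f \<i>" "vec.independent B" "eigenspace f \<i> \<subseteq> vec.span B" "card B = card P" and
    C: "C \<subseteq> eigenspace f (- \<i>)" "vec.independent C" "eigenspace f (- \<i>) \<subseteq> vec.span C"
       "card C = card (- P)"
  proof -
    have "card (- P) = vec.dim (eigenspace f (- \<i>))"
      using dim_eigenspaces [OF f] by (simp add: Compl_eq_Diff_UNIV card_Diff_subset P)
    then show thesis
      using that P by (metis vec.basis_exists)
  qed
  obtain b c where b: "bij_betw b P B" and c: "bij_betw c (- P) C"
    using B C by (metis finite finite_same_card_bij vec.finiteI_independent)
  define a :: "complex^'n^'n" where "a = (\<chi> i j. (if j \<in> P then b j else c j) $ i)"
  have col: "column j a = (if j \<in> P then b j else c j)" for j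
    by (simp add: column_def a_def vec_eq_iff)
  have "columns a = B \<union> C"
    using b c by (force simp: columns_def col bij_betw_def)
  moreover have "v \<in> vec.span (B \<union> C)" for v
  proof -
    have "v \<in> {x + y | x y. x \<in> eigenspace f \<i> \<and> y \<in> eigenspace f (- \<i>)}"
      by (simp only: eigenspaces_sum [OF f] UNIV_I)
    then obtain x y where "v = x + y" "x \<in> eigenspace f \<i>" "y \<in> eigenspace f (- \<i>)"
      by blast
    moreover have "vec.span B \<subseteq> vec.span (B \<union> C)" "vec.span C \<subseteq> vec.span (B \<union> C)"
      by (simp_all add: vec.span_mono)
    ultimately have "v = x + y" "x \<in> vec.span (B \<union> C)" "y \<in> vec.span (B \<union> C)"
      using B(3) C(3) by blast+
    then show ?thesis
      by (simp add: vec.span_add)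
  qed
  ultimately have "invertible a"
    unfolding invertible_right_inverse matrix_right_invertible_span_columns by auto
  moreover have "f ** a = a ** diag_root P"
  proof -
    have "(f ** a) $ i $ j = (a ** diag_root P) $ i $ j" for i j
    proof -
      have "(f ** a) $ i $ j = (f *v column j a) $ i"
        by (simp add: matrix_matrix_mult_def matrix_vector_mult_def column_def)
      also have "f *v column j a = (if j \<in> P then \<i> else - \<i>) *s column j a"
        using B(1) C(1) b c unfolding col eigenspace_def bij_betw_def by auto
      finally show ?thesis
        by (simp add: column_def mult_diag_root_component)
    qed
    then show ?thesis
      by (simp add: vec_eq_iff)
  qed
  ultimately show ?thesis
    using conjugate_iff by blast
qed

lemma ex_set_card:
  assumes "n \<le> CARD('n::finite)"
  shows "\<exists>P :: 'n set. card P = n"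
  using obtain_subset_with_card_n [OF assms] by blast

lemma square_root_ex_diag_root:
  fixes f :: "complex^'n^'n"
  assumes "f \<in> square_roots"
  obtains P where "card P = vec.dim (eigenspace f \<i>)" "conjugate f (diag_root P)"
  using ex_set_card dim_eigenspaces [OF assms] square_root_conjugate_diag_root [OF assms]
  by (metis le_add1)

lemma dim_eigenspace_diag_root:
  "vec.dim (eigenspace (diag_root P) \<i>) = card P"
  "vec.dim (eigenspace (diag_root P) (- \<i>)) = card (- P)"
proof -
  have "(diag_root P *v v) $ i = (if i \<in> P then \<i> else - \<i>) * v $ i" for v and i :: 'a
    by (simp add: diag_root_def matrix_vector_mult_def if_mult_distribs cong: if_cong)
  then have "eigenspace (diag_root P) \<i> = {v. \<forall>i. i \<notin> P \<longrightarrow> v $ i = 0}"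
    "eigenspace (diag_root P) (- \<i>) = {v. \<forall>i. i \<notin> - P \<longrightarrow> v $ i = 0}"
    by (auto simp: eigenspace_def vec_eq_iff)
  then show "vec.dim (eigenspace (diag_root P) \<i>) = card P"
    "vec.dim (eigenspace (diag_root P) (- \<i>)) = card (- P)"
    by (simp_all only: dim_substandard_cart)
qed

lemma conjugate_iff_dim_eigenspace:
  assumes "f \<in> square_roots" "g \<in> square_roots"
  shows "conjugate f g \<longleftrightarrow> vec.dim (eigenspace f \<i>) = vec.dim (eigenspace g \<i>)"
  using assms square_root_ex_diag_root square_root_conjugate_diag_root conjugate_dim_eigenspace
  by (metis conjugate_sym conjugate_trans)

text \<open>Since \<open>mat \<i>\<close> is central with square -1, its product with 2 e - 1
  squares to -1 exactly if 2 e - 1 is an involution, that is, if e is idempotent. The inverse map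
  assigns to \<open>f\<close> the projection onto its eigenspace for \<open>\<i>\<close>.\<close>

lemma bij_betw_idempotents_square_roots:
  "bij_betw (\<lambda>e::complex^'n^'n. mat \<i> ** (2 *\<^sub>R e - mat 1)) idempotents square_roots"
proof (rule bij_betw_byWitness [where f' = "\<lambda>f. (1/2) *\<^sub>R (mat 1 - mat \<i> ** f)"])
  have i: "mat \<i> ** (mat \<i> ** A) = - A" for A :: "complex^'n^'n"
    by (simp add: vec_eq_iff)
  have sq: "(mat \<i> ** A) ** (mat \<i> ** A) = - (A ** A)" for A :: "complex^'n^'n"
    by (metis i matrix_mul_assoc mat_mult_commute)
  show "\<forall>e\<in>idempotents. (1/2) *\<^sub>R (mat 1 - mat \<i> ** (mat \<i> ** (2 *\<^sub>R e - mat 1))) = (e::complex^'n^'n)"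
    by (simp add: i algebra_simps)
  show "\<forall>f\<in>square_roots. mat \<i> ** (2 *\<^sub>R ((1/2) *\<^sub>R (mat 1 - mat \<i> ** f)) - mat 1) = (f::complex^'n^'n)"
    by (simp add: i matrix_mult_distribs)
  show "(\<lambda>e. mat \<i> ** (2 *\<^sub>R e - mat 1)) ` idempotents \<subseteq> (square_roots :: (complex^'n^'n) set)"
  proof -
    have "(2 *\<^sub>R e - mat 1) ** (2 *\<^sub>R e - mat 1) = mat 1" if "e ** e = e" for e :: "complex^'n^'n"
      by (simp only: matrix_mult_distribs matrix_mul_lid matrix_mul_rid that scaleR_2) simp
    then show ?thesis
      by (auto simp: square_roots_def idempotents_def sq)
  qed
  show "(\<lambda>f. (1/2) *\<^sub>R (mat 1 - mat \<i> ** f)) ` square_roots \<subseteq> (idempotents :: (complex^'n^'n) set)"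
  proof -
    have "(1/2) *\<^sub>R (mat 1 - h) ** (1/2) *\<^sub>R (mat 1 - h) = (1/2) *\<^sub>R (mat 1 - h)"
      if "h ** h = mat 1" for h :: "complex^'n^'n"
      by (simp only: matrix_mult_distribs matrix_mul_lid matrix_mul_rid that)
         (simp add: vec_eq_iff complex_eq_iff field_simps)
    then show ?thesis
      by (auto simp: square_roots_def idempotents_def sq)
  qed
qed

section \<open>Center, commutators and the forms \<open>Scal\<close> and \<open>Spec\<close>\<close>

definition matrix_unit :: "'n \<Rightarrow> 'n \<Rightarrow> 'a::zero \<Rightarrow> 'a^'n^'n"
  where "matrix_unit i j c = (\<chi> r s. if r = i \<and> s = j then c else 0)"

lemma matrix_unit_mult_component:
  "(matrix_unit i j c ** A) $ r $ s = (if r = i then c * A $ j $ s else 0)" for A :: "'a::semiring_1^'n^'n"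
  by (simp add: matrix_unit_def matrix_matrix_mult_def if_mult_distribs sum.If_cases cong: if_cong)

lemma mult_matrix_unit_component:
  "(A ** matrix_unit i j c) $ r $ s = (if s = j then A $ r $ i * c else 0)" for A :: "'a::semiring_1^'n^'n"
  by (simp add: matrix_unit_def matrix_matrix_mult_def if_mult_distribs sum.If_cases cong: if_cong)

lemma matrix_center_eq: "matrix_center = range (mat :: complex \<Rightarrow> complex^'n^'n)"
proof (intro equalityI subsetI)
  fix z :: "complex^'n^'n" assume z: "z \<in> matrix_center"
  have *: "(if s = j then z $ r $ i else 0) = (if r = i then z $ j $ s else 0)" for i j r s
  proof -
    have "(z ** matrix_unit i j 1) $ r $ s = (matrix_unit i j 1 ** z) $ r $ s"
      using z unfolding matrix_center_def by simp
    then show ?thesis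
      by (simp add: matrix_unit_mult_component mult_matrix_unit_component cong: if_cong)
  qed
  obtain j :: 'n where True by blast
  \<comment> \<open>For \<open>s = j\<close> the identity above reads
    \<open>z $ r $ i = (if r = i then z $ j $ j else 0)\<close>, which determines every entry of
    \<open>z\<close>.\<close>
  have "z = mat (z $ j $ j)"
    using * [of j j] * [of _ _ j j] by (simp add: vec_eq_iff mat_def)
  then show "z \<in> range mat"
    by blast
qed (auto simp: matrix_center_def mat_mult_commute)

lemma commutator_space_eq: "commutator_space = {f :: complex^'n^'n. trace f = 0}"
proof (intro equalityI subsetI)
  fix f :: "complex^'n^'n" assume "f \<in> commutator_space"
  then have "f \<in> span {f ** g - g ** f | f g. True}"
    by (simp add: commutator_space_def)
  then have "trace f = 0"
  proof (rule span_induct)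
    show "subspace {f :: complex^'n^'n. trace f = 0}"
      by (auto simp: subspace_def trace_def sum.distrib simp flip: scaleR_sum_right)
  qed (auto simp: trace_sub intro: trace_mul_sym)
  then show "f \<in> {f. trace f = 0}"
    by simp
next
  fix f :: "complex^'n^'n" assume f: "f \<in> {f. trace f = 0}"
  obtain k :: 'n where True by blast
  \<comment> \<open>Writing \<open>E\<close> for matrix units, the commutator of \<open>E i k\<close> and \<open>c E k j\<close> is \<open>c E i j\<close>
    if \<open>i \<noteq> j\<close>, and \<open>c E i i - c E k k\<close> if \<open>i = j\<close>; the terms \<open>E k k\<close> add up to the trace.\<close>
  let ?c = "\<lambda>i j. matrix_unit i k 1 ** matrix_unit k j (f $ i $ j) -
                 matrix_unit k j (f $ i $ j) ** matrix_unit i k 1"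
  have "(\<Sum>i\<in>UNIV. \<Sum>j\<in>UNIV. ?c i j) \<in> commutator_space"
    unfolding commutator_space_def by (intro span_sum span_base) auto
  also have "(\<Sum>i\<in>UNIV. \<Sum>j\<in>UNIV. ?c i j) = f"
  proof -
    have c: "?c i j $ r $ s = (if s = j then if r = i then f $ i $ j else 0 else 0)
        - (if i = j then if r = k \<and> s = k then f $ i $ j else 0 else 0)" for i j r s
      by (auto simp: matrix_unit_mult_component) (auto simp: matrix_unit_def)
    have "(\<Sum>i\<in>UNIV. \<Sum>j\<in>UNIV. ?c i j) $ r $ s = f $ r $ s" for r s
    proof -
      have "(\<Sum>i\<in>UNIV. \<Sum>j\<in>UNIV. ?c i j) $ r $ s
          = f $ r $ s - (\<Sum>i\<in>UNIV. if r = k \<and> s = k then f $ i $ i else 0)"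
        unfolding sum_component c by (simp add: sum_subtractf)
      also have "(\<Sum>i\<in>UNIV. if r = k \<and> s = k then f $ i $ i else 0) = 0"
        using f by (cases "r = k"; cases "s = k") (simp_all add: trace_def)
      finally show ?thesis by simp
    qed
    then show ?thesis
      by (simp add: vec_eq_iff)
  qed
  finally show "f \<in> commutator_space" .
qed

lemma trace_mat: "trace (mat c :: 'a::comm_semiring_1^'n^'n) = of_nat CARD('n) * c"
  by (simp add: trace_def mat_def)

text \<open>The trace of \<open>mat c\<close> is \<open>c\<close> times the order, so exactly one
  scalar matrix differs from \<open>f\<close> by a matrix of trace 0. This settles existence and
  uniqueness for the description.\<close>

lemma center_projection_eq:
  fixes f :: "complex^'n^'n"
  shows "center_projection f = mat (trace f / of_nat CARD('n))"
  unfolding center_projection_def matrix_center_eq commutator_space_eq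
  by (rule the_equality) (auto simp: trace_sub trace_mat)

lemma center_decomposition_iff:
  "mat c = s *\<^sub>R mat 1 + t *\<^sub>R (omega :: complex^'n^'n) \<longleftrightarrow> s = Re c \<and> t = Im c"
  by (auto simp: omega_def vec_eq_iff mat_def complex_eq_iff)

lemma Scal_eq: "Scal f = Re (trace f) / real CARD('n)" for f :: "complex^'n^'n"
  by (simp add: Scal_def center_projection_eq center_decomposition_iff)

lemma Spec_eq: "Spec f = Im (trace f) / real CARD('n)" for f :: "complex^'n^'n"
  by (simp add: Spec_def center_projection_eq center_decomposition_iff)

section \<open>Charts and components\<close>

lemma cayley_chart:
  fixes p :: "complex^'n^'n"
  assumes p: "p \<in> square_roots"
  obtains U V \<phi> \<psi> where "p \<in> U" "smooth_diffeomorphism U V \<phi> \<psi>"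
    "\<phi> ` (U \<inter> square_roots) = V \<inter> {x. p ** x = - (x ** p)}"
    "U \<inter> square_roots \<subseteq> conj_class p"
proof -
  define U where "U = {f. invertible (mat 1 - p ** f)}"
  define V where "V = {x :: complex^'n^'n. invertible (mat 1 + x)}"
  \<comment> \<open>The Cayley transform, written so that matrix inversion is its only nonlinear ingredient.\<close>
  define \<phi> where "\<phi> f = 2 *\<^sub>R matrix_inv (mat 1 - p ** f) - mat 1" for f
  define \<psi> where "\<psi> x = p ** (2 *\<^sub>R matrix_inv (mat 1 + x) - mat 1)" for x
  have pp: "p ** p = - mat 1"
    using p by (simp add: square_roots_def)
  have ppx: "p ** (p ** x) = - x" for x :: "complex^'n^'n"
    by (simp add: matrix_mul_assoc pp matrix_mult_distribs)
  \<comment> \<open>The key to both round trips: \<open>mat 1 + \<phi> f\<close> is twice the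
    inverse of \<open>mat 1 - p ** f\<close>, and \<open>mat 1 - p ** \<psi> x\<close> is twice the
    inverse of \<open>mat 1 + x\<close>. Each round trip therefore amounts to inverting twice an
    inverse.\<close>
  have inv_half: "invertible (2 *\<^sub>R matrix_inv A)" "matrix_inv (2 *\<^sub>R matrix_inv A) = (1/2) *\<^sub>R A"
    if "invertible A" for A :: "complex^'n^'n"
  proof -
    show "invertible (2 *\<^sub>R matrix_inv A)"
      using that by (simp add: scalar_invertible)
    then show "matrix_inv (2 *\<^sub>R matrix_inv A) = (1/2) *\<^sub>R A"
      using that by (intro matrix_inv_unique_right) (simp_all add: matrix_mult_distribs)
  qed
  have \<phi>: "\<phi> f \<in> V" "\<psi> (\<phi> f) = f" if "f \<in> U" for f
  proof -
    have inv: "invertible (mat 1 - p ** f)"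
      using that by (simp add: U_def)
    show "\<phi> f \<in> V"
      using inv_half(1) [OF inv] by (simp add: \<phi>_def V_def)
    show "\<psi> (\<phi> f) = f"
      using inv_half(2) [OF inv] by (simp add: \<phi>_def \<psi>_def ppx matrix_mult.minus_right)
  qed
  have \<psi>: "\<psi> x \<in> U" "\<phi> (\<psi> x) = x" if "x \<in> V" for x
  proof -
    have inv: "invertible (mat 1 + x)"
      using that by (simp add: V_def)
    show "\<psi> x \<in> U"
      using inv_half(1) [OF inv] by (simp add: \<psi>_def U_def ppx)
    show "\<phi> (\<psi> x) = x"
      using inv_half(2) [OF inv] by (simp add: \<phi>_def \<psi>_def ppx)
  qed
  have L: "bounded_linear (\<lambda>f :: complex^'n^'n. - p ** f)"
    by (rule matrix_mult.bounded_linear_right)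
  have U: "U = (\<lambda>f. mat 1 - p ** f) -` {A. invertible A}" and V: "V = (\<lambda>x. mat 1 + x) -` {A. invertible A}"
    by (auto simp: U_def V_def)
  have "open U" "open V"
    unfolding U V
    by (intro open_vimage open_invertible continuous_intros matrix_mult.continuous_on)+
  have Ck: "Ck_on k \<phi> U" "Ck_on k \<psi> V" for k
  proof -
    note scale = Ck_on_bilinear [OF bounded_bilinear_scaleR]
    have "Ck_on k (\<lambda>f. 2 *\<^sub>R matrix_inv (mat 1 + - p ** f) + - mat 1) U"
      by (rule Ck_on_add [OF \<open>open U\<close> scale [OF \<open>open U\<close> Ck_on_const Ck_on_matrix_inv_affine [OF L]] Ck_on_const])
         (use \<open>open U\<close> in \<open>auto simp: U_def matrix_mult.minus_left\<close>)
    then show "Ck_on k \<phi> U"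
      by (simp add: \<phi>_def [abs_def] matrix_mult.minus_left)
    have "Ck_on k (\<lambda>x. 2 *\<^sub>R matrix_inv (mat 1 + x) + - mat 1) V"
      by (rule Ck_on_add [OF \<open>open V\<close> scale [OF \<open>open V\<close> Ck_on_const
             Ck_on_matrix_inv_affine [OF bounded_linear_ident]] Ck_on_const])
         (use \<open>open V\<close> in \<open>auto simp: V_def\<close>)
    then show "Ck_on k \<psi> V"
      using Ck_on_bilinear [OF bounded_bilinear_matrix_mult \<open>open V\<close> Ck_on_const [OF \<open>open V\<close>, of k p]]
      by (simp add: \<psi>_def [abs_def])
  qed
  have "smooth_diffeomorphism U V \<phi> \<psi>"
    unfolding smooth_diffeomorphism_def smooth_on_def
  proof (intro conjI allI \<open>open U\<close> \<open>open V\<close> Ck)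
    show "homeomorphism U V \<phi> \<psi>"
      using \<phi> \<psi> Ck [of 0] by (intro homeomorphismI) auto
  qed
  moreover have "p ** \<phi> f = - (\<phi> f ** p)" if "f \<in> U" "f \<in> square_roots" for f
  proof -
    define c w where "c = mat 1 - p ** f" and "w = matrix_inv c"
    have wc: "w ** c = mat 1" "c ** w = mat 1"
      using that by (simp_all add: U_def c_def w_def)
    have "f ** f = - mat 1"
      using that by (simp add: square_roots_def)
    then have ffx: "f ** (f ** x) = - x" for x :: "complex^'n^'n"
      by (simp add: matrix_mul_assoc matrix_mult_distribs)
    \<comment> \<open>The two sides differ by \<open>p + p ** (f ** f)\<close>, which is 0 for a
      square root.\<close>
    have "c ** p + p ** c = c ** p ** c"
      by (simp add: c_def matrix_mult_distribs ppx ffx pp \<open>f ** f = - mat 1\<close> flip: matrix_mul_assoc)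
    then have "w ** (c ** p + p ** c) ** w = w ** (c ** p ** c) ** w"
      by simp
    moreover have "w ** (c ** p + p ** c) ** w = p ** w + w ** p"
    proof -
      have "w ** (c ** p + p ** c) ** w = (w ** c) ** p ** w + w ** p ** (c ** w)"
        by (simp only: matrix_mult_distribs matrix_mul_assoc)
      then show ?thesis
        by (simp add: wc)
    qed
    moreover have "w ** (c ** p ** c) ** w = p"
    proof -
      have "w ** (c ** p ** c) ** w = (w ** c) ** p ** (c ** w)"
        by (simp only: matrix_mul_assoc)
      then show ?thesis
        by (simp add: wc)
    qed
    ultimately have "p ** w + w ** p = p"
      by simp
    then have "2 *\<^sub>R (p ** w) + 2 *\<^sub>R (w ** p) = p + p"
      by (metis scaleR_2 scaleR_right_distrib)
    then show ?thesis
      by (simp add: \<phi>_def matrix_mult_distribs algebra_simps flip: c_def w_def)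
  qed
  moreover have conj: "conjugate p (\<psi> x)" if "x \<in> V" "p ** x = - (x ** p)" for x
  proof -
    let ?v = "matrix_inv (mat 1 + x)"
    have inv: "invertible (mat 1 + x)"
      using that by (simp add: V_def)
    have "\<psi> x ** (mat 1 + x) = p ** (2 *\<^sub>R (?v ** (mat 1 + x)) - (mat 1 + x))"
      unfolding \<psi>_def
      by (simp only: matrix_mult.diff_left matrix_mult.scaleR_left matrix_mul_lid flip: matrix_mul_assoc)
    also have "\<dots> = p ** (mat 1 - x)"
      using inv by (simp add: scaleR_2)
    also have "\<dots> = (mat 1 + x) ** p"
      using that by (simp add: matrix_mult_distribs)
    finally show ?thesis
      using inv conjugate_iff conjugate_sym by blast
  qed
  ultimately have maps: "\<phi> ` (U \<inter> square_roots) = V \<inter> {x. p ** x = - (x ** p)}"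
  proof (intro equalityI subsetI)
    fix x assume x: "x \<in> V \<inter> {x. p ** x = - (x ** p)}"
    \<comment> \<open>That \<open>\<psi> x\<close> squares to -1 needs no computation: it is
      conjugate to \<open>p\<close>.\<close>
    then have "\<psi> x \<in> U \<inter> square_roots" "x = \<phi> (\<psi> x)"
      using \<psi> conj conjugate_square_roots [OF _ p] by auto
    then show "x \<in> \<phi> ` (U \<inter> square_roots)"
      by (rule rev_image_eqI)
  qed (use \<phi> in auto)
  moreover have "U \<inter> square_roots \<subseteq> conj_class p"
  proof
    fix f assume f: "f \<in> U \<inter> square_roots"
    then have "\<phi> f \<in> V" "p ** \<phi> f = - (\<phi> f ** p)"
      using maps by blast+
    then have "conjugate p (\<psi> (\<phi> f))"
      by (rule conj)
    then show "f \<in> conj_class p"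
      using \<phi>(2) f by (simp add: conj_class_def)
  qed
  moreover have "p \<in> U"
  proof -
    \<comment> \<open>At \<open>f = p\<close> the matrix to be inverted is twice the unit matrix;
      the chart takes \<open>p\<close> to 0.\<close>
    have "invertible (2 *\<^sub>R (mat 1 :: complex^'n^'n))"
      by (intro scalar_invertible invertibleI_left [of "mat 1"]) auto
    then show ?thesis
      by (simp add: U_def pp scaleR_2)
  qed
  ultimately show thesis
    using that \<open>smooth_diffeomorphism U V \<phi> \<psi>\<close> by blast
qed

section \<open>Real dimension of the straightened set\<close>

text \<open>This is a coordinate subspace: each position in \<open>Q\<close> carries two real basis
  vectors, one for 1 and one for \<open>\<i>\<close>, and \<open>?b\<close> lists them.\<close>

lemma dim_matrix_support:
  "dim {x :: complex^'n^'n. \<forall>i j. (i, j) \<notin> Q \<longrightarrow> x $ i $ j = 0} = 2 * card Q"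
proof -
  let ?b = "\<lambda>((i, j), u). axis i (axis j u) :: complex^'n^'n"
  have inj: "inj_on ?b (Q \<times> Basis)"
    by (auto simp: inj_on_def axis_eq_axis)
  have "{x :: complex^'n^'n. \<forall>i j. (i, j) \<notin> Q \<longrightarrow> x $ i $ j = 0}
      = {x. \<forall>e\<in>Basis. e \<notin> ?b ` (Q \<times> Basis) \<longrightarrow> x \<bullet> e = 0}"
  proof (intro Collect_cong iffI ballI allI impI)
    fix x e :: "complex^'n^'n"
    assume x: "\<forall>i j. (i, j) \<notin> Q \<longrightarrow> x $ i $ j = 0" and "e \<in> Basis" and e: "e \<notin> ?b ` (Q \<times> Basis)"
    then obtain i j u where "u \<in> Basis" "e = axis i (axis j u)"
      by (auto simp: Basis_vec_def)
    with e have "(i, j) \<notin> Q"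
      by force
    with x show "x \<bullet> e = 0"
      by (simp add: \<open>e = _\<close> inner_axis)
  next
    fix x :: "complex^'n^'n" and i j
    assume x: "\<forall>e\<in>Basis. e \<notin> ?b ` (Q \<times> Basis) \<longrightarrow> x \<bullet> e = 0" and ij: "(i, j) \<notin> Q"
    have "x $ i $ j \<bullet> u = 0" if "u \<in> Basis" for u
    proof -
      have "axis i (axis j u) \<notin> ?b ` (Q \<times> Basis)"
        using ij that by (auto simp: axis_eq_axis)
      then show ?thesis
        using x that by (auto simp: inner_axis dest!: bspec [of _ _ "axis i (axis j u)"])
    qed
    then show "x $ i $ j = 0"
      by (auto intro: euclidean_eqI [of "x $ i $ j"])
  qed
  also have "dim \<dots> = card (?b ` (Q \<times> Basis))"
    by (rule dim_substandard) auto
  also have "\<dots> = 2 * card Q"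
    by (simp add: card_image [OF inj] card_cartesian_product)
  finally show ?thesis .
qed

text \<open>Conjugation by \<open>a\<close> is a real-linear bijection from the anticommutant of the
  diagonal root onto that of \<open>p\<close>, so it suffices to count for the diagonal
  root.\<close>

lemma dim_anticommutant:
  fixes p :: "complex^'n^'n"
  assumes p: "p \<in> square_roots"
  shows "dim {x. p ** x = - (x ** p)} = 4 * vec.dim (eigenspace p \<i>) * vec.dim (eigenspace p (- \<i>))"
proof -
  obtain P where P: "conjugate p (diag_root P)"
    using square_root_ex_diag_root [OF p] by blast
  then obtain a where a: "invertible a" "p ** a = a ** diag_root P"
    unfolding conjugate_iff by blast
  let ?D = "diag_root P :: complex^'n^'n" and ?b = "matrix_inv a"
  have bp: "?b ** p = ?D ** ?b"
  proof -
    have "?b ** (p ** a) ** ?b = ?b ** (a ** ?D) ** ?b"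
      by (simp add: a(2))
    then show ?thesis
      using a(1) by (metis matrix_inv_left matrix_inv_right matrix_mul_assoc matrix_mul_lid matrix_mul_rid)
  qed
  let ?h = "\<lambda>x. a ** x ** ?b"
  have lin: "linear ?h"
    by (intro bounded_linear.linear bounded_linear_compose [OF matrix_mult.bounded_linear_left matrix_mult.bounded_linear_right])
  have hinv: "?b ** ?h x ** a = x" "?h (?b ** x ** a) = x" for x
  proof -
    have "?b ** ?h x ** a = (?b ** a) ** x ** (?b ** a)" "?h (?b ** x ** a) = (a ** ?b) ** x ** (a ** ?b)"
      by (simp_all only: matrix_mul_assoc)
    then show "?b ** ?h x ** a = x" "?h (?b ** x ** a) = x"
      using a(1) by simp_all
  qed
  have "{x. p ** x = - (x ** p)} = ?h ` {x. ?D ** x = - (x ** ?D)}"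
  proof (intro equalityI subsetI)
    fix x assume "x \<in> {x. p ** x = - (x ** p)}"
    then have "?b ** (p ** x) ** a = ?b ** (- (x ** p)) ** a"
      by simp
    then have "(?b ** p) ** x ** a = - (?b ** x ** (p ** a))"
      by (simp only: matrix_mult_distribs matrix_mul_assoc)
    then have "?b ** x ** a \<in> {x. ?D ** x = - (x ** ?D)}"
      by (simp add: bp a(2) matrix_mul_assoc)
    then show "x \<in> ?h ` {x. ?D ** x = - (x ** ?D)}"
      using hinv(2) by (metis (no_types, lifting) image_eqI)
  next
    fix y assume "y \<in> ?h ` {x. ?D ** x = - (x ** ?D)}"
    then obtain x where x: "y = ?h x" "?D ** x = - (x ** ?D)"
      by blast
    have "p ** ?h x = a ** (?D ** x) ** ?b"
      by (simp add: matrix_mul_assoc a(2))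
    also have "\<dots> = - (a ** x ** (?D ** ?b))"
      by (simp add: x(2) matrix_mult_distribs matrix_mul_assoc)
    also have "\<dots> = - (?h x ** p)"
      by (simp add: matrix_mul_assoc flip: bp)
    finally show "y \<in> {x. p ** x = - (x ** p)}"
      by (simp add: x(1))
  qed
  then have "dim {x. p ** x = - (x ** p)} = dim {x. ?D ** x = - (x ** ?D)}"
    using dim_image_eq [OF lin] hinv(1) by (metis (no_types, lifting) inj_onI)
  \<comment> \<open>With diagonal entries c_i, each \<open>\<i>\<close> or \<open>- \<i>\<close>,
    the equation says that c_i + c_j annihilates the entry of \<open>x\<close> at
    \<open>(i, j)\<close>. This sum vanishes exactly if one of the two indices lies in
    \<open>P\<close> and the other does not.\<close>
  also have "{x. ?D ** x = - (x ** ?D)} = {x. \<forall>i j. (i, j) \<notin> P \<times> (- P) \<union> (- P) \<times> P \<longrightarrow> x $ i $ j = 0}"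
    by (auto simp: vec_eq_iff diag_root_mult_component mult_diag_root_component)
  also have "dim \<dots> = 2 * card (P \<times> (- P) \<union> (- P) \<times> P)"
    by (rule dim_matrix_support)
  also have "card (P \<times> (- P) \<union> (- P) \<times> P) = 2 * card P * card (- P)"
    by (subst card_Un_disjoint) (auto simp: card_cartesian_product)
  finally show ?thesis
    by (simp add: conjugate_dim_eigenspace [OF P] dim_eigenspace_diag_root)
qed

lemma subspace_anticommutant: "subspace {x :: complex^'n^'n. p ** x = - (x ** p)}"
  by (auto simp: subspace_def matrix_mult_distribs)

text \<open>All sets between the class and \<open>square_roots\<close> coincide inside the chart
  domain, so one chart serves both the whole set of roots and the single class.\<close>

lemma submanifold_at_conj_class:
  assumes p: "p \<in> square_roots" and S: "conj_class p \<subseteq> S" "S \<subseteq> square_roots"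
  shows "submanifold_at S (4 * vec.dim (eigenspace p \<i>) * vec.dim (eigenspace p (- \<i>))) p"
proof -
  obtain U V \<phi> \<psi> where c: "p \<in> U" "smooth_diffeomorphism U V \<phi> \<psi>"
    "\<phi> ` (U \<inter> square_roots) = V \<inter> {x. p ** x = - (x ** p)}"
    "U \<inter> square_roots \<subseteq> conj_class p"
    using cayley_chart [OF p] by blast
  then have US: "U \<inter> S = U \<inter> square_roots"
    using S by blast
  show ?thesis
    unfolding submanifold_at_def
    by (rule exI [of _ U], rule exI [of _ V], rule exI [of _ \<phi>], rule exI [of _ \<psi>],
        rule exI [of _ "{x. p ** x = - (x ** p)}"])
       (simp add: US c subspace_anticommutant dim_anticommutant [OF p])
qed

section \<open>Conjugacy classes as connected components\<close>

lemma openin_conj_class: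
  assumes "f \<in> square_roots"
  shows "openin (top_of_set square_roots) (conj_class f)"
proof (subst openin_subopen, intro ballI)
  fix g assume g: "g \<in> conj_class f"
  then have "conjugate f g"
    by (simp add: conj_class_def)
  then have g': "g \<in> square_roots" "conj_class g = conj_class f"
    using assms by (blast intro: conjugate_square_roots, simp add: conj_class_eq_iff conjugate_sym)
  obtain U V \<phi> \<psi> where c: "g \<in> U" "smooth_diffeomorphism U V \<phi> \<psi>"
    "U \<inter> square_roots \<subseteq> conj_class g"
    using cayley_chart [OF g'(1)] by metis
  have "openin (top_of_set square_roots) (square_roots \<inter> U)"
    using c(2) by (simp add: smooth_diffeomorphism_def openin_open_Int)
  then show "\<exists>T. openin (top_of_set square_roots) T \<and> g \<in> T \<and> T \<subseteq> conj_class f"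
    using c g' by blast
qed

text \<open>The determinant is a polynomial in \<open>z\<close>, namely that of \<open>M\<close>
  over the polynomial ring, and it is not the zero polynomial because its value at 1 is the
  determinant of the unit matrix.\<close>

lemma finite_singular_segment:
  fixes a :: "complex^'n^'n"
  shows "finite {z. \<not> invertible (\<chi> i j. (1 - z) * a $ i $ j + z * mat 1 $ i $ j)}"
proof -
  define M :: "complex poly^'n^'n" where "M = (\<chi> i j. [:a $ i $ j, mat 1 $ i $ j - a $ i $ j:])"
  have "poly (det M) z = det (\<chi> i j. (1 - z) * a $ i $ j + z * mat 1 $ i $ j)" for z
    unfolding det_def by (simp add: M_def poly_sum poly_prod algebra_simps)
  moreover from this [of 1] have "det M \<noteq> 0"
    by (auto simp: vec_lambda_eta)
  ultimately show ?thesis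
    using poly_roots_finite [of "det M"] by (simp add: invertible_det_nz)
qed

lemma connected_conj_class: "connected (conj_class f)" for f :: "complex^'n^'n"
proof -
  have "\<exists>T. connected T \<and> f \<in> T \<and> g \<in> T \<and> T \<subseteq> conj_class f" if g: "conjugate f g" for g
  proof -
    obtain a where a: "invertible a" "g = matrix_inv a ** f ** a"
      using g unfolding conjugate_def by blast
    \<comment> \<open>The conjugating matrix is \<open>a\<close> at \<open>z = 0\<close>, which
      yields \<open>g\<close>, and the unit matrix at \<open>z = 1\<close>, which yields
      \<open>f\<close>.\<close>
    define m where "m z = (\<chi> i j. (1 - z) * a $ i $ j + z * mat 1 $ i $ j)" for z
    define Z where "Z = {z. invertible (m z)}"
    let ?c = "\<lambda>z. matrix_inv (m z) ** f ** m z"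
    have m: "m 0 = a" "m 1 = mat 1"
      by (simp_all add: m_def vec_lambda_eta)
    have "- Z = {z. \<not> invertible (m z)}"
      by (auto simp: Z_def)
    then have "finite (- Z)"
      using finite_singular_segment [of a] by (simp add: m_def)
    \<comment> \<open>This is why the parameter is complex: deleting finitely many points can
      disconnect a real segment, but never the plane.\<close>
    then have "connected (- (- Z))"
      by (intro path_connected_imp_connected path_connected_complement_countable) (simp_all add: countable_finite)
    then have "connected Z" by simp
    moreover have "continuous_on Z m"
      unfolding m_def by (intro continuous_intros)
    then have "continuous_on Z ?c"
      by (intro matrix_mult.continuous_on continuous_on_const continuous_on_compose2 [OF continuous_on_matrix_inv])
         (auto simp: Z_def)
    ultimately have conn: "connected (?c ` Z)"
      by (rule connected_continuous_image [rotated])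
    have one: "invertible (mat 1 :: complex^'n^'n)" "matrix_inv (mat 1 :: complex^'n^'n) = mat 1"
      using invertibleI_left [of "mat 1" "mat 1"] matrix_inv_unique_right [of "mat 1" "mat 1"] by simp_all
    have "?c 0 \<in> ?c ` Z" "?c 1 \<in> ?c ` Z"
      using a one by (intro imageI; simp add: m Z_def)+
    then have "g \<in> ?c ` Z" "f \<in> ?c ` Z"
      using a one by (simp_all add: m)
    moreover have "?c ` Z \<subseteq> conj_class f"
      by (auto simp: Z_def conj_class_def conjugate_def)
    ultimately show ?thesis
      using conn by blast
  qed
  then have "conj_class f = \<Union> {T. connected T \<and> f \<in> T \<and> T \<subseteq> conj_class f}"
    unfolding conj_class_def by blast
  also have "connected \<dots>"
    by (rule connected_Union) auto
  finally show ?thesis .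
qed

text \<open>The complement of a block is the union of the other blocks, hence open. So every block
  is clopen, and a connected set that contains it cannot be larger.\<close>

lemma components_eqI:
  assumes "\<Union> \<C> = S" "disjoint \<C>"
    and C: "\<And>C. C \<in> \<C> \<Longrightarrow> C \<noteq> {} \<and> connected C \<and> openin (top_of_set S) C"
  shows "components S = \<C>"
proof -
  have *: "C \<in> components S" if "C \<in> \<C>" for C
    unfolding in_components_maximal
  proof (intro conjI allI impI)
    show "C \<noteq> {}" "connected C" "C \<subseteq> S"
      using C assms(1) that by auto
    fix D assume D: "D \<noteq> {} \<and> C \<subseteq> D \<and> D \<subseteq> S \<and> connected D"
    have "S - C = \<Union> (\<C> - {C})"
      using assms(1,2) that by (auto simp: disjoint_def)
    then have "openin (top_of_set S) (S - C)"
      using C by auto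
    then have "closedin (top_of_set S) C"
      using \<open>C \<subseteq> S\<close> by (simp add: closedin_def double_diff)
    then have "closedin (top_of_set D) C" "openin (top_of_set D) C"
      using C that D by (meson closedin_subset_trans openin_subset_trans)+
    then show "D = C"
      using D \<open>C \<noteq> {}\<close> connected_clopen by metis
  qed
  show ?thesis
  proof (intro equalityI subsetI *)
    fix K assume K: "K \<in> components S"
    then obtain x where "x \<in> K" "x \<in> S"
      using in_components_nonempty in_components_subset by blast
    then obtain C where "C \<in> \<C>" "x \<in> C"
      using assms(1) by blast
    then show "K \<in> \<C>"
      using components_eq [OF K *] \<open>x \<in> K\<close> by blast
  qed
qed

lemma Union_conj_class_square_roots: "\<Union> (conj_class ` square_roots) = square_roots"
  using conjugate_refl conjugate_square_roots by (fastforce simp: conj_class_def)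

lemma components_square_roots:
  "components square_roots = conj_class ` (square_roots :: (complex^'n^'n) set)"
proof (rule components_eqI [OF Union_conj_class_square_roots])
  show "disjoint (conj_class ` (square_roots :: (complex^'n^'n) set))"
    unfolding disjoint_def
  proof (intro ballI impI)
    fix C D :: "(complex^'n^'n) set"
    assume "C \<in> conj_class ` square_roots" "D \<in> conj_class ` square_roots" and ne: "C \<noteq> D"
    then obtain f g :: "complex^'n^'n" where fg: "C = conj_class f" "D = conj_class g"
      by blast
    show "C \<inter> D = {}"
    proof (rule ccontr)
      assume "C \<inter> D \<noteq> {}"
      then obtain h where "conjugate f h" "conjugate g h"
        unfolding fg conj_class_def by blast
      then have "conj_class f = conj_class h" "conj_class g = conj_class h"
        by (simp_all only: conj_class_eq_iff)
      then show False
        using ne fg by simp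
    qed
  qed
qed (use conjugate_refl connected_conj_class openin_conj_class in \<open>auto simp: conj_class_def\<close>)

section \<open>Classes of square roots\<close>

text \<open>The two dimensions add up to \<open>2 * d\<close>, so either equation of
  \<open>has_index\<close> implies the other, and an index always exists.\<close>

lemma has_index_iff:
  fixes f :: "complex^'n^'n"
  assumes "f \<in> square_roots" "CARD('n) = 2 * d"
  shows "has_index d f k \<longleftrightarrow> k = int (vec.dim (eigenspace f \<i>)) - int d"
  using dim_eigenspaces [OF assms(1)] assms(2) unfolding has_index_def by linarith

text \<open>The diagonal form has trace \<open>\<i>\<close> times |P| - |-P| = 2 (|P| - d). Reading
  the index off the trace gives access to \<open>Scal\<close> and \<open>Spec\<close>, to the effect
  of complex conjugation and to the index of \<open>omega\<close>.\<close>

lemma has_index_iff_trace: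
  fixes f :: "complex^'n^'n"
  assumes f: "f \<in> square_roots" and d: "CARD('n) = 2 * d"
  shows "has_index d f k \<longleftrightarrow> trace f = 2 * \<i> * of_int k"
proof -
  obtain P where P: "card P = vec.dim (eigenspace f \<i>)" "conjugate f (diag_root P)"
    using square_root_ex_diag_root [OF f] by blast
  have "card (- P) + card P = 2 * d"
    using d card_mono [of UNIV P] by (simp add: Compl_eq_Diff_UNIV card_Diff_subset)
  then have "int (card P) - int (card (- P)) = 2 * (int (card P) - int d)"
    by arith
  then have "(of_nat (card P) - of_nat (card (- P)) :: complex) = 2 * of_int (int (card P) - int d)"
    by (metis of_int_diff of_int_mult of_int_numeral of_int_of_nat_eq)
  then have "trace f = 2 * \<i> * of_int (int (card P) - int d)"
    by (simp add: conjugate_trace [OF P(2)] trace_diag_root)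
  then show ?thesis
    unfolding has_index_iff [OF f d] by (auto simp: P(1) simp del: of_int_diff of_int_of_nat_eq)
qed

lemma square_root_index:
  fixes f :: "complex^'n^'n"
  assumes f: "f \<in> square_roots" and d: "CARD('n) = 2 * d"
  obtains k where "- int d \<le> k" "k \<le> int d" "has_index d f k"
  using dim_eigenspaces [OF f] d has_index_iff [OF f d]
    that [of "int (vec.dim (eigenspace f \<i>)) - int d"] by force

lemma conjugate_iff_has_index:
  fixes f g :: "complex^'n^'n"
  assumes "f \<in> square_roots" "g \<in> square_roots" "CARD('n) = 2 * d" "has_index d f k" "has_index d g l"
  shows "conjugate f g \<longleftrightarrow> k = l"
  using assms by (simp add: conjugate_iff_dim_eigenspace has_index_iff)

lemma root_class_eq_conj_class:
  fixes f :: "complex^'n^'n"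
  assumes f: "f \<in> root_class d k" and d: "CARD('n) = 2 * d"
  shows "root_class d k = conj_class f"
proof (intro equalityI subsetI)
  fix g :: "complex^'n^'n" assume "g \<in> root_class d k"
  then show "g \<in> conj_class f"
    using f d conjugate_iff_has_index [of f g d k k] by (simp add: root_class_def conj_class_def)
next
  fix g :: "complex^'n^'n" assume "g \<in> conj_class f"
  then have "conjugate f g"
    by (simp add: conj_class_def)
  then show "g \<in> root_class d k"
    using f conjugate_square_roots conjugate_has_index unfolding root_class_def by blast
qed

lemma root_class_nonempty:
  assumes d: "CARD('n) = 2 * d" and k: "k \<in> {- int d..int d}"
  obtains f :: "complex^'n^'n" where "f \<in> root_class d k"
proof -
  have "nat (int d + k) \<le> CARD('n)"
    using d k by auto
  then obtain P :: "'n set" where P: "card P = nat (int d + k)"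
    using ex_set_card by blast
  have "has_index d (diag_root P) k"
    using k by (simp add: has_index_iff [OF diag_root_in_square_roots d] dim_eigenspace_diag_root P)
  then have "diag_root P \<in> root_class d k"
    by (simp add: root_class_def diag_root_in_square_roots)
  then show thesis
    by (rule that)
qed

lemma inj_on_root_class:
  assumes d: "CARD('n) = 2 * d"
  shows "inj_on (root_class d :: int \<Rightarrow> (complex^'n^'n) set) {- int d..int d}"
proof (rule inj_onI)
  fix k l assume k: "k \<in> {- int d..int d}" and eq: "root_class d k = (root_class d l :: (complex^'n^'n) set)"
  obtain f :: "complex^'n^'n" where "f \<in> root_class d k"
    using root_class_nonempty [OF d k] .
  moreover from this have "f \<in> root_class d l"
    by (simp add: eq)
  ultimately show "k = l"
    using has_index_unique unfolding root_class_def by blast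
qed

lemma bij_betw_root_class:
  assumes d: "CARD('n) = 2 * d"
  shows "bij_betw (root_class d) {- int d..int d} (conj_class ` (square_roots :: (complex^'n^'n) set))"
  unfolding bij_betw_def
proof (intro conjI inj_on_root_class [OF d] equalityI subsetI)
  fix C :: "(complex^'n^'n) set"
  assume "C \<in> root_class d ` {- int d..int d}"
  then obtain k where k: "k \<in> {- int d..int d}" "C = root_class d k"
    by blast
  obtain f :: "complex^'n^'n" where f: "f \<in> root_class d k"
    using root_class_nonempty [OF d k(1)] .
  then have "f \<in> square_roots"
    by (simp add: root_class_def)
  then show "C \<in> conj_class ` square_roots"
    using root_class_eq_conj_class [OF f d] k(2) by blast
next
  fix C :: "(complex^'n^'n) set"
  assume "C \<in> conj_class ` square_roots"
  then obtain f where f: "f \<in> square_roots" "C = conj_class f"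
    by blast
  obtain k where k: "- int d \<le> k" "k \<le> int d" "has_index d f k"
    using square_root_index [OF f(1) d] .
  then have "f \<in> root_class d k"
    using f(1) by (simp add: root_class_def)
  then have "C = root_class d k"
    using root_class_eq_conj_class [OF _ d] f(2) by blast
  then show "C \<in> root_class d ` {- int d..int d}"
    using k by auto
qed

lemma submanifold_square_roots: "submanifold (square_roots :: (complex^'n^'n) set)"
  unfolding submanifold_def
proof
  fix p :: "complex^'n^'n" assume p: "p \<in> square_roots"
  have "conj_class p \<subseteq> square_roots"
    using conjugate_square_roots [OF _ p] by (auto simp: conj_class_def)
  then show "\<exists>m. submanifold_at square_roots m p"
    using submanifold_at_conj_class [OF p _ subset_refl] by blast
qed

lemma submanifold_of_dim_root_class:
  assumes d: "CARD('n) = 2 * d"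
  shows "submanifold_of_dim (root_class d k :: (complex^'n^'n) set) (4 * nat (int d + k) * nat (int d - k))"
  unfolding submanifold_of_dim_def
proof
  fix p :: "complex^'n^'n" assume p: "p \<in> root_class d k"
  \<comment> \<open>A member \<open>p\<close> forces both d + k and d - k to be dimensions, hence
    nonnegative, so \<open>nat\<close> truncates nothing.\<close>
  then have dims: "nat (int d + k) = vec.dim (eigenspace p \<i>)" "nat (int d - k) = vec.dim (eigenspace p (- \<i>))"
    by (auto simp: root_class_def has_index_def)
  have "p \<in> square_roots" "conj_class p \<subseteq> root_class d k" "root_class d k \<subseteq> square_roots"
    using p root_class_eq_conj_class [OF p d] by (auto simp: root_class_def)
  then show "submanifold_at (root_class d k) (4 * nat (int d + k) * nat (int d - k)) p"
    unfolding dims by (rule submanifold_at_conj_class)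
qed

section \<open>Entrywise complex conjugation and the two central roots\<close>

lemma cnj_matrix_cnj_matrix [simp]: "cnj_matrix (cnj_matrix f) = f"
  by (simp add: cnj_matrix_def vec_eq_iff)

lemma cnj_matrix_mult: "cnj_matrix (f ** g) = cnj_matrix f ** cnj_matrix g"
  by (simp add: cnj_matrix_def matrix_matrix_mult_def vec_eq_iff)

lemma cnj_matrix_mat: "cnj_matrix (mat c) = mat (cnj c)"
  by (simp add: cnj_matrix_def mat_def vec_eq_iff)

lemma trace_cnj_matrix: "trace (cnj_matrix f) = cnj (trace f)"
  by (simp add: cnj_matrix_def trace_def)

lemma real_algebra_automorphism_cnj_matrix:
  "real_algebra_automorphism (cnj_matrix :: complex^'n^'n \<Rightarrow> complex^'n^'n)"
  unfolding real_algebra_automorphism_def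
proof (intro conjI allI)
  show "bij (cnj_matrix :: complex^'n^'n \<Rightarrow> complex^'n^'n)"
    by (rule o_bij [of cnj_matrix]) (simp_all add: fun_eq_iff)
  show "linear (cnj_matrix :: complex^'n^'n \<Rightarrow> complex^'n^'n)"
    by (rule linearI) (simp_all add: cnj_matrix_def vec_eq_iff)
qed (simp_all add: cnj_matrix_mult cnj_matrix_mat)

text \<open>The trace 2 \<i> k turns into its conjugate, which is the trace belonging to
  \<open>- k\<close>. The other inclusion follows because conjugation is an involution.\<close>

lemma cnj_matrix_root_class:
  assumes d: "CARD('n) = 2 * d"
  shows "cnj_matrix ` (root_class d k :: (complex^'n^'n) set) = root_class d (- k)"
proof -
  have cnj: "cnj_matrix f \<in> root_class d (- k)" if "f \<in> root_class d k" for f :: "complex^'n^'n" and k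
  proof -
    have f: "f \<in> square_roots" "trace f = 2 * \<i> * of_int k"
      using that has_index_iff_trace [OF _ d] by (auto simp: root_class_def)
    have "cnj_matrix f ** cnj_matrix f = cnj_matrix (mat (- 1))"
      using f(1) by (simp add: square_roots_def uminus_mat flip: cnj_matrix_mult)
    then have "cnj_matrix f \<in> square_roots"
      by (simp add: square_roots_def cnj_matrix_mat uminus_mat)
    then show ?thesis
      using f(2) by (simp add: root_class_def has_index_iff_trace [OF _ d] trace_cnj_matrix)
  qed
  show ?thesis
  proof (intro equalityI subsetI)
    fix f :: "complex^'n^'n" assume "f \<in> root_class d (- k)"
    then have "cnj_matrix f \<in> root_class d k"
      using cnj [of f "- k"] by simp
    then show "f \<in> cnj_matrix ` root_class d k"
      by (metis cnj_matrix_cnj_matrix image_eqI)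
  qed (use cnj in auto)
qed

lemma conj_class_mat: "conj_class (mat c) = {mat c :: complex^'n^'n}"
proof (intro equalityI subsetI)
  fix g :: "complex^'n^'n" assume "g \<in> conj_class (mat c)"
  then obtain a :: "complex^'n^'n" where "invertible a" "g = matrix_inv a ** mat c ** a"
    unfolding conj_class_def conjugate_def by blast
  then show "g \<in> {mat c}"
    by (simp flip: mat_mult_commute) (simp flip: matrix_mul_assoc)
qed (simp add: conj_class_def conjugate_refl)

text \<open>At order \<open>2 * d\<close> the trace of \<open>omega\<close> is 2 \<i> d, so
  \<open>omega\<close> and \<open>- omega\<close> have indices d and -d. Scalar matrices are fixed
  by every conjugation, so each is alone in its class.\<close>

lemma root_class_omega:
  assumes d: "CARD('n) = 2 * d"
  shows "root_class d (int d) = {omega :: complex^'n^'n}"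
    and "root_class d (- int d) = {- omega :: complex^'n^'n}"
proof -
  have "mat c \<in> (square_roots :: (complex^'n^'n) set)" if "c = \<i> \<or> c = - \<i>" for c
    using that by (auto simp: square_roots_def mat_mult_mat uminus_mat)
  then have mem: "(mat \<i> :: complex^'n^'n) \<in> root_class d (int d)" "(mat (- \<i>) :: complex^'n^'n) \<in> root_class d (- int d)"
    by (simp_all add: root_class_def has_index_iff_trace [OF _ d] trace_mat d)
  then show "root_class d (int d) = {omega :: complex^'n^'n}"
    "root_class d (- int d) = {- omega :: complex^'n^'n}"
    using mem [THEN root_class_eq_conj_class [OF _ d]] by (simp_all add: conj_class_mat omega_def uminus_mat)
qed

theorem mainTheorem5:
  fixes d :: nat
  assumes "d \<ge> 1" and "CARD('n::finite) = 2 * d"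
  shows
    "DIM(complex^'n^'n) = 8 * d\<^sup>2

   \<and> \<comment> \<open>(1)\<close>
     bij_betw (\<lambda>\<epsilon>::complex^'n^'n. mat \<i> ** (2 *\<^sub>R \<epsilon> - mat 1)) idempotents square_roots

   \<and> \<comment> \<open>(2)\<close>
     (\<forall>f\<in>(square_roots :: (complex^'n^'n) set).
        {x + y | x y. x \<in> eigenspace f \<i> \<and> y \<in> eigenspace f (- \<i>)} = UNIV
      \<and> eigenspace f \<i> \<inter> eigenspace f (- \<i>) = {0}
      \<and> (\<exists>k. - int d \<le> k \<and> k \<le> int d \<and> has_index d f k
           \<and> Scal f = 0 \<and> Spec f = real_of_int k / real d))

   \<and> \<comment> \<open>(3)\<close>
     (\<forall>f\<in>(square_roots :: (complex^'n^'n) set). \<forall>g\<in>square_roots. \<forall>k l.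
        has_index d f k \<longrightarrow> has_index d g l \<longrightarrow> (conjugate f g \<longleftrightarrow> k = l))
   \<and> bij_betw (root_class d) {- int d..int d}
        (conj_class ` (square_roots :: (complex^'n^'n) set))
   \<and> \<Union> (conj_class ` (square_roots :: (complex^'n^'n) set)) = square_roots
   \<and> card (conj_class ` (square_roots :: (complex^'n^'n) set)) = 2 * d + 1
   \<and> submanifold (square_roots :: (complex^'n^'n) set)
   \<and> components (square_roots :: (complex^'n^'n) set) = conj_class ` square_roots

   \<and> \<comment> \<open>(4)\<close>
     (\<forall>k\<in>{- int d..int d}. \<exists>m.
        submanifold_of_dim (root_class d k :: (complex^'n^'n) set) m
      \<and> int m = 4 * ((int d)\<^sup>2 - k\<^sup>2)
      \<and> (k = 0 \<longrightarrow> real m = real DIM(complex^'n^'n) / 2)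
      \<and> (k \<noteq> 0 \<longrightarrow> real m < real DIM(complex^'n^'n) / 2))
   \<and> card ((root_class d :: int \<Rightarrow> (complex^'n^'n) set) ` ({- int d..int d} - {0})) = 2 * d

   \<and> \<comment> \<open>(5)\<close>
     real_algebra_automorphism (cnj_matrix :: complex^'n^'n \<Rightarrow> complex^'n^'n)
   \<and> (\<forall>k\<in>{- int d..int d}.
        cnj_matrix ` (root_class d k :: (complex^'n^'n) set) = root_class d (- k))
   \<and> cnj_matrix ` (root_class d 0 :: (complex^'n^'n) set) = root_class d 0
   \<and> root_class d (int d) = {omega :: complex^'n^'n}
   \<and> root_class d (- int d) = {- omega :: complex^'n^'n}
   \<and> cnj_matrix ` {omega :: complex^'n^'n} = {- omega}"
proof (intro conjI ballI allI impI)
  note d = assms(2)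
  show DIM: "DIM(complex^'n^'n) = 8 * d\<^sup>2"
    by (simp add: d power2_eq_square)
  show "bij_betw (\<lambda>\<epsilon>::complex^'n^'n. mat \<i> ** (2 *\<^sub>R \<epsilon> - mat 1)) idempotents square_roots"
    by (rule bij_betw_idempotents_square_roots)
  show "bij_betw (root_class d) {- int d..int d} (conj_class ` (square_roots :: (complex^'n^'n) set))"
    by (rule bij_betw_root_class [OF d])
  then show "card (conj_class ` (square_roots :: (complex^'n^'n) set)) = 2 * d + 1"
    by (simp flip: bij_betw_same_card)
  show "\<Union> (conj_class ` (square_roots :: (complex^'n^'n) set)) = square_roots"
    by (rule Union_conj_class_square_roots)
  show "submanifold (square_roots :: (complex^'n^'n) set)"
    by (rule submanifold_square_roots)
  show "components (square_roots :: (complex^'n^'n) set) = conj_class ` square_roots"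
    by (rule components_square_roots)
  have "inj_on (root_class d :: int \<Rightarrow> (complex^'n^'n) set) ({- int d..int d} - {0})"
    using inj_on_root_class [OF d] by (rule inj_on_subset) blast
  then show "card ((root_class d :: int \<Rightarrow> (complex^'n^'n) set) ` ({- int d..int d} - {0})) = 2 * d"
    by (simp add: card_image)
  show "real_algebra_automorphism (cnj_matrix :: complex^'n^'n \<Rightarrow> complex^'n^'n)"
    by (rule real_algebra_automorphism_cnj_matrix)
  show "cnj_matrix ` (root_class d k :: (complex^'n^'n) set) = root_class d (- k)" for k
    by (rule cnj_matrix_root_class [OF d])
  from this [of 0] show "cnj_matrix ` (root_class d 0 :: (complex^'n^'n) set) = root_class d 0"
    by simp
  show "root_class d (int d) = {omega :: complex^'n^'n}" "root_class d (- int d) = {- omega :: complex^'n^'n}"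
    by (rule root_class_omega [OF d])+
  show "cnj_matrix ` {omega :: complex^'n^'n} = {- omega}"
    by (simp add: omega_def cnj_matrix_mat uminus_mat)
next
  fix f g :: "complex^'n^'n" and k l
  assume "f \<in> square_roots" "g \<in> square_roots" "has_index d f k" "has_index d g l"
  then show "conjugate f g = (k = l)"
    using assms(2) by (intro conjugate_iff_has_index)
next
  fix f :: "complex^'n^'n" assume f: "f \<in> square_roots"
  show "{x + y | x y. x \<in> eigenspace f \<i> \<and> y \<in> eigenspace f (- \<i>)} = UNIV"
    by (rule eigenspaces_sum [OF f])
  show "eigenspace f \<i> \<inter> eigenspace f (- \<i>) = {0}"
    by (rule eigenspaces_Int)
  obtain k where k: "- int d \<le> k" "k \<le> int d" "has_index d f k"
    using square_root_index [OF f assms(2)] .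
  then have "trace f = 2 * \<i> * of_int k"
    by (simp add: has_index_iff_trace [OF f assms(2)])
  \<comment> \<open>The trace is purely imaginary, and dividing 2 k by the order
    \<open>2 * d\<close> leaves k / d.\<close>
  then have "Scal f = 0" "Spec f = real_of_int k / real d"
    by (simp_all add: Scal_eq Spec_eq assms(2))
  with k show "\<exists>k. - int d \<le> k \<and> k \<le> int d \<and> has_index d f k \<and> Scal f = 0 \<and> Spec f = real_of_int k / real d"
    by blast
next
  fix k assume k: "k \<in> {- int d..int d}"
  define m where "m = 4 * nat (int d + k) * nat (int d - k)"
  have m: "int m = 4 * ((int d)\<^sup>2 - k\<^sup>2)"
    using k by (simp add: m_def power2_eq_square algebra_simps)
  then have "real m = 4 * ((real d)\<^sup>2 - (real_of_int k)\<^sup>2)"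
    by (metis (mono_tags) of_int_diff of_int_mult of_int_numeral of_int_of_nat_eq of_int_power)
  \<comment> \<open>Half of the real dimension of the algebra exceeds \<open>m\<close> by exactly 4
    k^2.\<close>
  moreover have "real DIM(complex^'n^'n) / 2 = 4 * (real d)\<^sup>2"
    by (simp add: assms(2) power2_eq_square)
  ultimately have "k = 0 \<longrightarrow> real m = real DIM(complex^'n^'n) / 2"
    "k \<noteq> 0 \<longrightarrow> real m < real DIM(complex^'n^'n) / 2"
    by simp_all
  with m show "\<exists>m. submanifold_of_dim (root_class d k :: (complex^'n^'n) set) m
      \<and> int m = 4 * ((int d)\<^sup>2 - k\<^sup>2)
      \<and> (k = 0 \<longrightarrow> real m = real DIM(complex^'n^'n) / 2)
      \<and> (k \<noteq> 0 \<longrightarrow> real m < real DIM(complex^'n^'n) / 2)"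
    using submanifold_of_dim_root_class [OF assms(2)] m_def by blast
qed

end
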